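(* Let $G$ be a bipartite graph. Then (i) if $\delta(G)\ge1$, $\mu_{\mathrm{int}}(G)\le\left\lceil\frac{\Delta(G)}{\delta(G)}\right\rceil$; and (ii) $\mu_{\mathrm{int}}(G)\le\left\lceil\frac{\Delta(G)}{3}\right\rceil$.
   Context: Graphs are finite and simple; $\Delta(G)$ and $\delta(G)$ denote maximum and minimum degree. A $k$-improper edge coloring of $G$ is a map $\alpha:E(G)\to\mathbb{N}$ such that at most $k$ edges with a common endpoint receive the same color; it is an improper interval coloring if at every vertex the colors on incident edges form a set of consecutive integers. $\mu_{\mathrm{int}}(G)$ is the smallest $k$ such that $G$ has a $k$-improper interval edge coloring. *)

theory Defs
  imports Complex_Main
begin

(* A graph is given by its vertex set and its set of edges, the edges being two-element vertex sets. *)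

definition simple_graph :: "'a set \<Rightarrow> 'a set set \<Rightarrow> bool" where
  "simple_graph V E \<longleftrightarrow> finite V \<and> (\<forall>e\<in>E. e \<subseteq> V \<and> card e = 2)"

definition bipartite :: "'a set \<Rightarrow> 'a set set \<Rightarrow> bool" where
  "bipartite V E \<longleftrightarrow>
     (\<exists>X Y. X \<union> Y = V \<and> X \<inter> Y = {} \<and> (\<forall>e\<in>E. \<exists>x\<in>X. \<exists>y\<in>Y. e = {x, y}))"

definition incident_edges :: "'a set set \<Rightarrow> 'a \<Rightarrow> 'a set set" where
  "incident_edges E v = {e \<in> E. v \<in> e}"

definition degree :: "'a set set \<Rightarrow> 'a \<Rightarrow> nat" where
  "degree E v = card (incident_edges E v)"

(* Max {} and Min {} are unspecified, so the next two carry no information when V is empty. *)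

definition max_degree :: "'a set \<Rightarrow> 'a set set \<Rightarrow> nat" where
  "max_degree V E = Max (degree E ` V)"

definition min_degree :: "'a set \<Rightarrow> 'a set set \<Rightarrow> nat" where
  "min_degree V E = Min (degree E ` V)"

(* Only the values of \<alpha> on E matter in the predicates below. *)

definition improper_edge_coloring ::
    "nat \<Rightarrow> 'a set \<Rightarrow> 'a set set \<Rightarrow> ('a set \<Rightarrow> nat) \<Rightarrow> bool" where
  "improper_edge_coloring k V E \<alpha> \<longleftrightarrow>
     (\<forall>v\<in>V. \<forall>c. card {e \<in> incident_edges E v. \<alpha> e = c} \<le> k)"

(* The interval {a..b} may be empty, so an isolated vertex imposes no condition. *)

definition interval_edge_coloring ::
    "'a set \<Rightarrow> 'a set set \<Rightarrow> ('a set \<Rightarrow> nat) \<Rightarrow> bool" where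
  "interval_edge_coloring V E \<alpha> \<longleftrightarrow>
     (\<forall>v\<in>V. \<exists>a b. \<alpha> ` incident_edges E v = {a..b})"

(* k = 0 is allowed, so that an edgeless graph has value 0. *)

definition mu_int :: "'a set \<Rightarrow> 'a set set \<Rightarrow> nat" where
  "mu_int V E =
     (LEAST k. \<exists>\<alpha>. improper_edge_coloring k V E \<alpha> \<and> interval_edge_coloring V E \<alpha>)"

lemma simple_graph_finite_edges: "simple_graph V E \<Longrightarrow> finite E"
  unfolding simple_graph_def by (meson PowI finite_Pow_iff finite_subset subsetI)

lemma interval_edge_coloring_const: "interval_edge_coloring V E (\<lambda>_. c)"
proof -
  have "\<exists>a b. (\<lambda>_. c) ` incident_edges E v = {a..b}" for v
  proof (cases "incident_edges E v = {}")
    case True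
    then have "(\<lambda>_. c) ` incident_edges E v = {Suc 0..0}" by simp
    then show ?thesis by blast
  next
    case False
    then have "(\<lambda>_. c) ` incident_edges E v = {c..c}" by auto
    then show ?thesis by blast
  qed
  then show ?thesis unfolding interval_edge_coloring_def by blast
qed

(* A constant coloring shows that the minimum defining mu_int is attained. *)

lemma mu_int_attained:
  assumes "simple_graph V E"
  shows "\<exists>\<alpha>. improper_edge_coloring (mu_int V E) V E \<alpha> \<and> interval_edge_coloring V E \<alpha>"
proof -
  have fin: "finite E" using assms by (rule simple_graph_finite_edges)
  have "improper_edge_coloring (card E) V E (\<lambda>_. 0)"
    unfolding improper_edge_coloring_def incident_edges_def
    using fin by (auto intro!: card_mono)
  then have "\<exists>\<alpha>. improper_edge_coloring (card E) V E \<alpha> \<and> interval_edge_coloring V E \<alpha>"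
    using interval_edge_coloring_const by blast
  then show ?thesis unfolding mu_int_def by (rule LeastI)
qed

end

theory Submission
  imports Defs
begin

text \<open>
  Split every vertex of degree \<open>d\<close> into blocks of \<open>t\<close> edges and one smaller block. The split graph
  is bipartite of maximum degree \<open>t\<close>, and a colour used at most once in each block is used at most
  \<open>\<lceil>d/t\<rceil>\<close> times at the original vertex.
  For (i), take \<open>t = \<delta>(G)\<close> and a proper \<open>t\<close>-edge-colouring of the split graph (Koenig): every vertex has
  a full block and so sees all colours.
  For (ii), take \<open>t = 3\<close>. The split graph has a proper interval colouring with colours \<open>1,\<dots>,4\<close>
  (Hansen); a full block sees \<open>{1,2,3}\<close> or \<open>{2,3,4}\<close>, and joining any colours from \<open>1,\<dots>,4\<close> to either of
  these leaves an interval.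

  Hansen's colouring: let \<open>M\<close> be a colour class of a proper 3-edge-colouring, a matching that
  covers all vertices of degree 3. Delete from the graph the edges of \<open>M\<close> with an end of degree other
  than 2. The rest has maximum degree 2 and a proper edge colouring with colours 2 and 3, in which the
  two edges next to an edge of \<open>M\<close> have the same colour. So the edges of \<open>M\<close> can be
  recoloured with 1 and 4, consistently with the single other edge at each end of degree 2.
\<close>

section \<open>Proper edge colourings of bipartite multigraphs\<close>

text \<open>A bipartite multigraph is given by a finite edge set and two maps sending an edge to its ends.\<close>

abbreviation fiber :: "'e set \<Rightarrow> ('e \<Rightarrow> 'b) \<Rightarrow> 'b \<Rightarrow> 'e set" where
  "fiber E f x \<equiv> {e \<in> E. f e = x}"

text \<open>Properness is tested at one end map, so that each lemma serves both sides of the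
  bipartition; a proper colouring satisfies it for \<open>f\<close> and for
  \<open>g\<close>.\<close>

definition proper_at :: "'e set \<Rightarrow> ('e \<Rightarrow> 'b) \<Rightarrow> ('e \<Rightarrow> nat) \<Rightarrow> bool" where
  "proper_at E f c \<longleftrightarrow> (\<forall>e\<in>E. \<forall>e'\<in>E. f e = f e' \<longrightarrow> c e = c e' \<longrightarrow> e = e')"

lemma proper_atD: "proper_at E f c \<Longrightarrow> e \<in> E \<Longrightarrow> e' \<in> E \<Longrightarrow> f e = f e' \<Longrightarrow> c e = c e' \<Longrightarrow> e = e'"
  unfolding proper_at_def by blast

lemma proper_at_inj_on: "proper_at E f c \<Longrightarrow> inj_on c (fiber E f x)"
  unfolding proper_at_def inj_on_def by auto

text \<open>The path that starts at the end \<open>u\<close> with an edge of colour \<open>b\<close> and alternates between \<open>b\<close> and \<open>a\<close>;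
  by bipartiteness its \<open>b\<close>-edges are left through \<open>g\<close> and its \<open>a\<close>-edges through \<open>f\<close>.\<close>

inductive_set kempe :: "'e set \<Rightarrow> ('e \<Rightarrow> 'b) \<Rightarrow> ('e \<Rightarrow> 'd) \<Rightarrow> ('e \<Rightarrow> nat) \<Rightarrow> nat \<Rightarrow> nat \<Rightarrow> 'b \<Rightarrow> 'e set"
  for E f g c a b u where
  start: "h \<in> E \<Longrightarrow> f h = u \<Longrightarrow> c h = b \<Longrightarrow> h \<in> kempe E f g c a b u"
| step_g: "h \<in> kempe E f g c a b u \<Longrightarrow> c h = b \<Longrightarrow> h' \<in> E \<Longrightarrow> c h' = a \<Longrightarrow> g h' = g h
    \<Longrightarrow> h' \<in> kempe E f g c a b u"
| step_f: "h \<in> kempe E f g c a b u \<Longrightarrow> c h = a \<Longrightarrow> h' \<in> E \<Longrightarrow> c h' = b \<Longrightarrow> f h' = f h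
    \<Longrightarrow> h' \<in> kempe E f g c a b u"

text \<open>Exchanging \<open>a\<close> and \<open>b\<close> along the path from \<open>u\<close>
  frees \<open>b\<close> at \<open>u\<close>. The path enters vertices on the \<open>g\<close> side
  only by \<open>b\<close>-edges, so it never reaches \<open>v\<close>, where \<open>b\<close> stays
  free.\<close>

lemma kempe_swap:
  assumes pf: "proper_at E f c" and pg: "proper_at E g c" and ab: "a \<noteq> b"
    and ua: "\<And>h. h \<in> E \<Longrightarrow> f h = u \<Longrightarrow> c h \<noteq> a"
    and vb: "\<And>h. h \<in> E \<Longrightarrow> g h = v \<Longrightarrow> c h \<noteq> b"
  shows "\<exists>c'. proper_at E f c' \<and> proper_at E g c' \<and> c' ` E \<subseteq> c ` E \<union> {a, b} \<and>
    (\<forall>h\<in>E. f h = u \<longrightarrow> c' h \<noteq> b) \<and> (\<forall>h\<in>E. g h = v \<longrightarrow> c' h \<noteq> b)"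
proof -
  let ?S = "kempe E f g c a b u"
  define c' where "c' h = (if h \<in> ?S then (if c h = a then b else a) else c h)" for h
  have col: "c h = a \<or> c h = b" and SE: "h \<in> E" if "h \<in> ?S" for h
    using that by (induction) auto
  have pred_a: "\<exists>k\<in>?S. c k = b \<and> g k = g h" if "h \<in> ?S" "c h = a" for h
    using that ab by (cases) auto
  have pred_b: "f h = u \<or> (\<exists>k\<in>?S. c k = a \<and> f k = f h)" if "h \<in> ?S" "c h = b" for h
    using that ab by (cases) auto
  \<comment> \<open>An \<open>a\<close>- or \<open>b\<close>-edge that shares an end with a path
    edge is on the path: either the path continues along it, or by properness it is the path edge
    itself or its predecessor. Only \<open>u\<close> lacks a predecessor, and no
    \<open>a\<close>-edge ends there.\<close>
  have closed_f: "h' \<in> ?S" if h: "h \<in> ?S" "h' \<in> E" "f h' = f h" "c h' = a \<or> c h' = b" for h h'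
  proof (cases "c h = a")
    case True
    then show ?thesis
      using that pf SE by (metis kempe.step_f proper_atD)
  next
    case False
    then have hb: "c h = b" using col that by blast
    show ?thesis
    proof (cases "c h' = a")
      case True
      then have "f h \<noteq> u" using ua that by metis
      then obtain k where "k \<in> ?S" "c k = a" "f k = f h" using pred_b h(1) hb by blast
      then show ?thesis using that True pf SE by (metis proper_atD)
    next
      case False
      then show ?thesis using that hb pf SE by (metis proper_atD)
    qed
  qed
  have closed_g: "h' \<in> ?S" if h: "h \<in> ?S" "h' \<in> E" "g h' = g h" "c h' = a \<or> c h' = b" for h h'
  proof (cases "c h = a")
    case True
    then obtain k where "k \<in> ?S" "c k = b" "g k = g h" using pred_a h(1) by blast
    then show ?thesis using that pg SE True by (metis proper_atD)
  next
    case False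
    then have hb: "c h = b" using col that by blast
    then show ?thesis using that pg SE by (metis kempe.step_g proper_atD)
  qed
  \<comment> \<open>So a clash between a path edge and an edge off the path could only involve the
    colours \<open>a\<close> and \<open>b\<close>, and closure excludes it at a common end.\<close>
  have leave: "c y = a \<or> c y = b" if "x \<in> ?S" "y \<notin> ?S" "c' x = c' y" for x y
    using that col[of x] by (auto simp: c'_def split: if_splits)
  have "proper_at E f c'"
    unfolding proper_at_def
  proof (intro ballI impI)
    fix e e' assume h: "e \<in> E" "e' \<in> E" "f e = f e'" "c' e = c' e'"
    have "e \<in> ?S \<longleftrightarrow> e' \<in> ?S"
      using leave[of e e'] leave[of e' e] closed_f h by metis
    then have "c e = c e'"
      using h(4) col[of e] col[of e'] ab by (auto simp: c'_def split: if_splits)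
    then show "e = e'" using h pf by (metis proper_atD)
  qed
  moreover have "proper_at E g c'"
    unfolding proper_at_def
  proof (intro ballI impI)
    fix e e' assume h: "e \<in> E" "e' \<in> E" "g e = g e'" "c' e = c' e'"
    have "e \<in> ?S \<longleftrightarrow> e' \<in> ?S"
      using leave[of e e'] leave[of e' e] closed_g h by metis
    then have "c e = c e'"
      using h(4) col[of e] col[of e'] ab by (auto simp: c'_def split: if_splits)
    then show "e = e'" using h pg by (metis proper_atD)
  qed
  moreover have "c' ` E \<subseteq> c ` E \<union> {a, b}"
    by (auto simp: c'_def)
  moreover have "c' h \<noteq> b" if "h \<in> E" "f h = u" for h
    using that ua[of h] ab kempe.start[of h E f u c b g a] by (auto simp: c'_def)
  \<comment> \<open>A path edge recoloured to \<open>b\<close> was an \<open>a\<close>-edge, and its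
    predecessor would be a \<open>b\<close>-edge at \<open>v\<close>.\<close>
  moreover have "c' h \<noteq> b" if "h \<in> E" "g h = v" for h
    using that vb[of h] ab pred_a[of h] vb SE by (auto simp: c'_def)
  ultimately show ?thesis by blast
qed

lemma free_colour:
  assumes "finite E" "card (fiber E f x) < t"
  shows "\<exists>a<t. \<forall>h\<in>E. f h = x \<longrightarrow> c h \<noteq> a"
proof (rule ccontr)
  assume "\<not> ?thesis"
  then have "{..<t} \<subseteq> c ` fiber E f x" by fastforce
  then have "card {..<t} \<le> card (fiber E f x)"
    using assms(1) by (intro surj_card_le) auto
  then show False using assms(2) by simp
qed

text \<open>Induction on the edges. The new edge finds a colour \<open>a\<close> free at one end and
  \<open>b\<close> free at the other; if they differ, a Kempe swap makes \<open>b\<close> free at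
  both.\<close>

theorem koenig_edge_colouring:
  assumes "finite E"
    and "\<And>x. card (fiber E f x) \<le> t" and "\<And>y. card (fiber E g y) \<le> t"
  shows "\<exists>c. c ` E \<subseteq> {..<t} \<and> proper_at E f c \<and> proper_at E g c"
  using assms
proof (induction E rule: finite_induct)
  case empty
  then show ?case by (auto simp: proper_at_def)
next
  case (insert e E)
  have smaller: "card (fiber E h (h e)) < t" "card (fiber E h x) \<le> t"
    if "\<And>x. card (fiber (insert e E) h x) \<le> t" for h :: "'a \<Rightarrow> 'z" and x
  proof -
    have "fiber (insert e E) h (h e) = insert e (fiber E h (h e))" by auto
    then show "card (fiber E h (h e)) < t" using that[of "h e"] insert by simp
    show "card (fiber E h x) \<le> t"
      using that[of x] insert(1) card_mono[of "fiber (insert e E) h x" "fiber E h x"]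
      by fastforce
  qed
  obtain c where c: "c ` E \<subseteq> {..<t}" "proper_at E f c" "proper_at E g c"
    using insert.IH smaller(2)[OF insert.prems(1)] smaller(2)[OF insert.prems(2)] by blast
  obtain a where a: "a < t" "\<And>h. h \<in> E \<Longrightarrow> f h = f e \<Longrightarrow> c h \<noteq> a"
    using free_colour[OF insert(1) smaller(1)[OF insert.prems(1)]] by blast
  obtain b where b: "b < t" "\<And>h. h \<in> E \<Longrightarrow> g h = g e \<Longrightarrow> c h \<noteq> b"
    using free_colour[OF insert(1) smaller(1)[OF insert.prems(2)]] by blast
  have "\<exists>c'. c' ` E \<subseteq> {..<t} \<and> proper_at E f c' \<and> proper_at E g c' \<and>
    (\<forall>h\<in>E. f h = f e \<longrightarrow> c' h \<noteq> b) \<and> (\<forall>h\<in>E. g h = g e \<longrightarrow> c' h \<noteq> b)"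
  proof (cases "a = b")
    case True
    then show ?thesis using a b c by blast
  next
    case False
    obtain c' where "proper_at E f c'" "proper_at E g c'" "c' ` E \<subseteq> c ` E \<union> {a, b}"
      "\<forall>h\<in>E. f h = f e \<longrightarrow> c' h \<noteq> b" "\<forall>h\<in>E. g h = g e \<longrightarrow> c' h \<noteq> b"
      using kempe_swap[OF c(2,3) False a(2) b(2)] by blast
    moreover have "c ` E \<union> {a, b} \<subseteq> {..<t}" using a(1) b(1) c(1) by auto
    ultimately show ?thesis by (meson order_trans)
  qed
  then obtain c' where c': "c' ` E \<subseteq> {..<t}" "proper_at E f c'" "proper_at E g c'"
    "\<forall>h\<in>E. f h = f e \<longrightarrow> c' h \<noteq> b" "\<forall>h\<in>E. g h = g e \<longrightarrow> c' h \<noteq> b" by blast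
  have "(c'(e := b)) ` insert e E \<subseteq> {..<t}" using c'(1) b(1) by auto
  moreover have "proper_at (insert e E) f (c'(e := b))"
    using c'(2,4) unfolding proper_at_def by auto
  moreover have "proper_at (insert e E) g (c'(e := b))"
    using c'(3,5) unfolding proper_at_def by auto
  ultimately show ?case by blast
qed

text \<open>Distinct colours on \<open>t\<close> edges exhaust a palette of size \<open>t\<close>.
  Hence full blocks see all colours, and a colour class covers all vertices of maximum
  degree.\<close>

lemma proper_at_full_fiber:
  assumes "finite E" "c ` E \<subseteq> {..<t}" "proper_at E f c" "card (fiber E f x) = t"
  shows "c ` fiber E f x = {..<t}"
proof (rule card_subset_eq)
  show "card (c ` fiber E f x) = card {..<t}"
    using assms by (simp add: card_image proper_at_inj_on)
qed (use assms in auto)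

section \<open>Splitting vertices into blocks\<close>

text \<open>Number the edges at each vertex from 0 and put edge \<open>n\<close> into block
  \<open>n div t\<close>. The second property bounds the number of blocks; the third says that block
  0 is full once the degree reaches \<open>t\<close>.\<close>

lemma block_index:
  fixes f :: "'e \<Rightarrow> 'b"
  assumes "finite E" "t > 0"
  shows "\<exists>i. (\<forall>p. card (fiber E (\<lambda>e. (f e, i e :: nat)) p) \<le> t) \<and>
    (\<forall>e\<in>E. t * i e < card (fiber E f (f e))) \<and>
    (\<forall>x. t \<le> card (fiber E f x) \<longrightarrow> card (fiber E (\<lambda>e. (f e, i e)) (x, 0)) = t)"
proof -
  have "\<exists>h. bij_betw h (fiber E f x) {0..<card (fiber E f x)}" for x
    using assms(1) by (intro ex_bij_betw_finite_nat) auto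
  then obtain h where h: "\<And>x. bij_betw (h x) (fiber E f x) {0..<card (fiber E f x)}"
    by metis
  define i where "i e = h (f e) e div t" for e
  have blk: "card (fiber E (\<lambda>e. (f e, i e)) (x, j)) =
      card {n. n < card (fiber E f x) \<and> n div t = j}" for x j
  proof -
    have "bij_betw (h x) (fiber E (\<lambda>e. (f e, i e)) (x, j)) {n. n < card (fiber E f x) \<and> n div t = j}"
    proof (rule bij_betw_imageI)
      show "inj_on (h x) (fiber E (\<lambda>e. (f e, i e)) (x, j))"
        by (rule inj_on_subset[OF bij_betw_imp_inj_on[OF h[of x]]]) auto
      have "h x ` fiber E (\<lambda>e. (f e, i e)) (x, j) = {n \<in> h x ` fiber E f x. n div t = j}"
        by (auto simp: i_def)
      then show "h x ` fiber E (\<lambda>e. (f e, i e)) (x, j) = {n. n < card (fiber E f x) \<and> n div t = j}"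
        using bij_betw_imp_surj_on[OF h[of x]] by auto
    qed
    then show ?thesis by (rule bij_betw_same_card)
  qed
  have "card (fiber E (\<lambda>e. (f e, i e)) p) \<le> t" for p
  proof (cases p)
    case (Pair x j)
    have "n \<in> {t * j..<t * j + t}" if "n div t = j" for n
      using that assms(2) div_mult_mod_eq[of n t] mod_less_divisor[of t n]
      by (auto simp: mult.commute simp del: div_mult_mod_eq mod_less_divisor)
    then have "card {n. n < card (fiber E f x) \<and> n div t = j} \<le> card {t * j..<t * j + t}"
      by (intro card_mono) auto
    then show ?thesis using Pair blk by simp
  qed
  moreover have "t * i e < card (fiber E f (f e))" if "e \<in> E" for e
  proof -
    have "h (f e) e < card (fiber E f (f e))"
      using bij_betw_apply[OF h[of "f e"], of e] that by auto
    then show ?thesis unfolding i_def by (meson le_less_trans times_div_less_eq_dividend)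
  qed
  moreover have "card (fiber E (\<lambda>e. (f e, i e)) (x, 0)) = t" if "t \<le> card (fiber E f x)" for x
  proof -
    have "{n. n < card (fiber E f x) \<and> n div t = 0} = {..<t}"
      using that assms(2) by (auto simp: div_eq_0_iff)
    then show ?thesis using blk by simp
  qed
  ultimately show ?thesis by blast
qed

text \<open>The block index is injective on the edges of one colour at \<open>x\<close>, and all
  indices there are below \<open>K\<close>.\<close>

lemma blockwise_proper_card_le:
  assumes "finite E" "proper_at E (\<lambda>e. (f e, i e)) c"
    and idx: "\<And>e. e \<in> E \<Longrightarrow> t * i e < card (fiber E f (f e))"
    and "card (fiber E f x) \<le> K * t"
  shows "card {e \<in> fiber E f x. c e = k} \<le> K"
proof -
  have "i e < K" if "e \<in> fiber E f x" for e
  proof -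
    have "t * i e < card (fiber E f x)" using idx[of e] that by auto
    also have "\<dots> \<le> t * K" using assms(4) by (simp add: mult.commute)
    finally have "t * i e < t * K" .
    then show ?thesis by simp
  qed
  moreover have "inj_on i {e \<in> fiber E f x. c e = k}"
    using assms(2) by (auto simp: inj_on_def proper_at_def)
  ultimately show ?thesis
    using card_inj_on_le[of i "{e \<in> fiber E f x. c e = k}" "{..<K}"] by auto
qed

text \<open>Koenig's theorem is applied to the split graph, whose vertices are the pairs of a vertex
  and a block index. One colouring serves every \<open>K\<close>.\<close>

theorem balanced_edge_colouring:
  assumes "finite E" "t > 0"
  shows "\<exists>c. \<forall>K.
    (\<forall>x. card (fiber E f x) \<le> K * t \<longrightarrow> (\<forall>k. card {e \<in> fiber E f x. c e = k} \<le> K)) \<and>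
    (\<forall>y. card (fiber E g y) \<le> K * t \<longrightarrow> (\<forall>k. card {e \<in> fiber E g y. c e = k} \<le> K)) \<and>
    (\<forall>x. t \<le> card (fiber E f x) \<longrightarrow> c ` fiber E f x = {..<t}) \<and>
    (\<forall>y. t \<le> card (fiber E g y) \<longrightarrow> c ` fiber E g y = {..<t})"
proof -
  obtain i where i: "\<And>p. card (fiber E (\<lambda>e. (f e, i e)) p) \<le> t"
      "\<And>e. e \<in> E \<Longrightarrow> t * i e < card (fiber E f (f e))"
      "\<And>x. t \<le> card (fiber E f x) \<Longrightarrow> card (fiber E (\<lambda>e. (f e, i e)) (x, 0)) = t"
    using block_index[OF assms, of f] by blast
  obtain j where j: "\<And>p. card (fiber E (\<lambda>e. (g e, j e)) p) \<le> t"
      "\<And>e. e \<in> E \<Longrightarrow> t * j e < card (fiber E g (g e))"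
      "\<And>y. t \<le> card (fiber E g y) \<Longrightarrow> card (fiber E (\<lambda>e. (g e, j e)) (y, 0)) = t"
    using block_index[OF assms, of g] by blast
  obtain c where c: "c ` E \<subseteq> {..<t}" "proper_at E (\<lambda>e. (f e, i e)) c" "proper_at E (\<lambda>e. (g e, j e)) c"
    using koenig_edge_colouring[OF assms(1) i(1) j(1)] by blast
  have all: "c ` fiber E h x = {..<t}"
    if "proper_at E (\<lambda>e. (h e, l e)) c" "card (fiber E (\<lambda>e. (h e, l e)) (x, 0)) = t"
    for h :: "'a \<Rightarrow> 'z" and l :: "'a \<Rightarrow> nat" and x
  proof
    show "c ` fiber E h x \<subseteq> {..<t}" using c(1) by auto
    have "{..<t} = c ` fiber E (\<lambda>e. (h e, l e)) (x, 0)"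
      using proper_at_full_fiber[OF assms(1) c(1) that] by simp
    also have "\<dots> \<subseteq> c ` fiber E h x" by auto
    finally show "{..<t} \<subseteq> c ` fiber E h x" .
  qed
  show ?thesis
    using blockwise_proper_card_le[OF assms(1) c(2) i(2)]
      blockwise_proper_card_le[OF assms(1) c(3) j(2)] all[OF c(2) i(3)] all[OF c(3) j(3)]
    by (intro exI[of _ c]) blast
qed

section \<open>Interval colourings of subcubic bipartite multigraphs\<close>

text \<open>Local check at one vertex with edge set \<open>F\<close>. Edges outside \<open>M\<close>
  get 2 or 3, the edge of \<open>M\<close> gets 1 or 4. At degree 3 either choice extends
  \<open>{2,3}\<close>; at degree 2 the hypothesis \<open>pair\<close> makes the result
  \<open>{1,2}\<close> or \<open>{3,4}\<close>.\<close>

lemma interval_fiber: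
  fixes c c1 :: "'e \<Rightarrow> nat"
  assumes fin: "finite F" and le: "card F \<le> 3"
    and M: "\<And>e e'. e \<in> F \<inter> M \<Longrightarrow> e' \<in> F \<inter> M \<Longrightarrow> e = e'"
    and full: "card F = 3 \<Longrightarrow> F \<inter> M \<noteq> {}"
    and inj: "inj_on c1 (F - M)" and c1: "\<And>e. e \<in> F - M \<Longrightarrow> c1 e < 2"
    and cF: "\<And>e. e \<in> F - M \<Longrightarrow> c e = 2 + c1 e"
    and cM: "\<And>e. e \<in> F \<inter> M \<Longrightarrow> c e = 1 \<or> c e = 4"
    and pair: "\<And>e e'. card F = 2 \<Longrightarrow> e \<in> F \<inter> M \<Longrightarrow> e' \<in> F - M \<Longrightarrow> c e = (if c1 e' = 1 then 4 else 1)"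
  shows "inj_on c F \<and> c ` F \<subseteq> {1..4} \<and> (\<exists>a b. c ` F = {a..b})"
proof -
  have rangeF: "c e = 2 \<or> c e = 3" if "e \<in> F - M" for e
    using cF[OF that] c1[OF that] by auto
  have injFM: "c e \<noteq> c e'" if "e \<in> F - M" "e' \<in> F - M" "e \<noteq> e'" for e e'
    using that cF inj by (auto simp: inj_on_def)
  have cFM: "c e \<noteq> c e'" if "e \<in> F - M" "e' \<in> F \<inter> M" for e e'
    using rangeF[OF that(1)] cM[OF that(2)] by auto
  have injc: "inj_on c F"
  proof (rule inj_onI, rule ccontr)
    fix e e' assume "e \<in> F" "e' \<in> F" "c e = c e'" "e \<noteq> e'"
    then show False
      using M[of e e'] injFM[of e e'] cFM[of e e'] cFM[of e' e] by (cases "e \<in> M"; cases "e' \<in> M") auto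
  qed
  have range: "c ` F \<subseteq> {1..4}"
  proof -
    have "c e \<in> {1..4}" if "e \<in> F" for e
      using that rangeF[of e] cM[of e] by (cases "e \<in> M") auto
    then show ?thesis by blast
  qed
  have ivs: "{1..2} = {1, 2::nat}" "{2..3} = {2, 3::nat}" "{3..4} = {3, 4::nat}"
    "{1..3} = {1, 2, 3::nat}" "{2..4} = {2, 3, 4::nat}" by auto
  consider "card F = 0" | "card F = 1" | "card F = 2" | "card F = 3" using le by linarith
  then have "\<exists>a b. c ` F = {a..b}"
  proof cases
    case 1
    then have "c ` F = {1..0}" using fin by simp
    then show ?thesis by blast
  next
    case 2
    then obtain e where "F = {e}" by (auto simp: card_1_singleton_iff)
    then have "c ` F = {c e..c e}" by simp
    then show ?thesis by blast
  next
    case 3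
    then obtain p q where F: "F = {p, q}" "p \<noteq> q" by (auto simp: card_2_iff)
    have *: "c ` {p, q} \<in> {{1..2}, {2..3}, {3..4}}" if "F = {p, q}" "p \<noteq> q" "q \<notin> M" for p q
    proof (cases "p \<in> M")
      case True
      then have "c p = (if c1 q = 1 then 4 else 1)" "c q = 2 + c1 q" "c1 q < 2"
        using pair[OF 3, of p q] cF[of q] c1[of q] that by auto
      then show ?thesis unfolding ivs by (auto simp: less_2_cases_iff)
    next
      case False
      then show ?thesis using rangeF[of p] rangeF[of q] injFM[of p q] that unfolding ivs by auto
    qed
    have "p \<notin> M \<or> q \<notin> M" using M F by auto
    then have "c ` F \<in> {{1..2}, {2..3}, {3..4}}"
      using *[of p q] *[of q p] F by (auto simp: insert_commute)
    then show ?thesis by blast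
  next
    case 4
    then obtain p where p: "p \<in> F \<inter> M" using full by blast
    have "card (F - {p}) = 2" using 4 p fin by simp
    then obtain q r where qr: "F - {p} = {q, r}" "q \<noteq> r" by (auto simp: card_2_iff)
    have nM: "q \<in> F - M" "r \<in> F - M" using M p qr by auto
    have "F = {p, q, r}" using p qr by auto
    then have "c ` F \<in> {{1..3}, {2..4}}"
      using cM[OF p] rangeF[OF nM(1)] rangeF[OF nM(2)] injFM[OF nM qr(2)] unfolding ivs by auto
    then show ?thesis by blast
  qed
  then show ?thesis using injc range by blast
qed

text \<open>The palette \<open>{1..4}\<close> is recorded because a full block then misses only an
  extreme colour, 1 or 4.\<close>

definition interval4_at :: "'e set \<Rightarrow> ('e \<Rightarrow> 'b) \<Rightarrow> ('e \<Rightarrow> nat) \<Rightarrow> bool" where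
  "interval4_at E f c \<longleftrightarrow>
     (\<forall>x. inj_on c (fiber E f x) \<and> c ` fiber E f x \<subseteq> {1..4} \<and> (\<exists>a b. c ` fiber E f x = {a..b}))"

lemma interval4_at_imp_proper_at: "interval4_at E f c \<Longrightarrow> proper_at E f c"
  unfolding interval4_at_def inj_on_def proper_at_def by blast

theorem subcubic_interval_colouring:
  assumes fin: "finite E"
    and df: "\<And>x. card (fiber E f x) \<le> 3" and dg: "\<And>y. card (fiber E g y) \<le> 3"
  shows "\<exists>c. interval4_at E f c \<and> interval4_at E g c"
proof -
  obtain c0 where c0: "c0 ` E \<subseteq> {..<3}" "proper_at E f c0" "proper_at E g c0"
    using koenig_edge_colouring[OF assms] by blast
  define M where "M = {e \<in> E. c0 e = 0}"
  define H where
    "H = {e \<in> E. e \<in> M \<longrightarrow> card (fiber E f (f e)) = 2 \<and> card (fiber E g (g e)) = 2}"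
  have Mcov: "fiber E h x \<inter> M \<noteq> {}" if "proper_at E h c0" "card (fiber E h x) = 3"
    for h :: "'a \<Rightarrow> 'z" and x
  proof -
    have "0 \<in> c0 ` fiber E h x" using proper_at_full_fiber[OF fin c0(1) that] by simp
    then show ?thesis by (auto simp: M_def)
  qed
  \<comment> \<open>At a vertex of degree 3 the edge of \<open>M\<close> is not in \<open>H\<close>,
    which leaves two edges; any other vertex has degree at most 2 already.\<close>
  have Hle: "card (fiber H h x) \<le> 2"
    if proper: "proper_at E h c0" and le: "card (fiber E h x) \<le> 3"
      and two: "\<And>e. e \<in> H \<inter> M \<Longrightarrow> card (fiber E h (h e)) = 2"
    for h :: "'a \<Rightarrow> 'z" and x
  proof (cases "card (fiber E h x) = 3")
    case True
    then obtain e where e: "e \<in> fiber E h x \<inter> M" using Mcov[OF proper] by blast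
    then have "e \<notin> H" using two[of e] True by auto
    then have "fiber H h x \<subseteq> fiber E h x - {e}" by (auto simp: H_def)
    then have "card (fiber H h x) \<le> card (fiber E h x - {e})" using fin by (intro card_mono) auto
    then show ?thesis using e True fin by simp
  next
    case False
    have "card (fiber H h x) \<le> card (fiber E h x)" using fin by (intro card_mono) (auto simp: H_def)
    then show ?thesis using False le by linarith
  qed
  have "finite H" using fin by (simp add: H_def)
  moreover have "card (fiber H f x) \<le> 2" for x
    by (rule Hle[OF c0(2) df]) (auto simp: H_def)
  moreover have "card (fiber H g x) \<le> 2" for x
    by (rule Hle[OF c0(3) dg]) (auto simp: H_def)
  ultimately obtain c1 where c1: "c1 ` H \<subseteq> {..<2}" "proper_at H f c1" "proper_at H g c1"
    using koenig_edge_colouring[of H f 2 g] by blast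
  \<comment> \<open>Colour 4 must be used next to a 3 at an end of degree 2, and colour 1 next to a
    2. Ends of other degrees impose nothing.\<close>
  define next4 where "next4 e \<longleftrightarrow> (\<exists>e'\<in>E - M. c1 e' = 1 \<and>
      ((card (fiber E f (f e)) = 2 \<and> f e' = f e) \<or> (card (fiber E g (g e)) = 2 \<and> g e' = g e)))" for e
  define c where "c e = (if e \<in> M then (if next4 e then 4 else 1) else 2 + c1 e)" for e
  have EH: "E - M \<subseteq> H" by (auto simp: H_def)
  have c1_less: "c1 e < 2" if "e \<in> H" for e using c1(1) that by auto
  have no_three: False if "card (fiber E h x) = 2" "e1 \<in> M" "h e1 = x" "e2 \<in> E - M" "h e2 = x"
      "e3 \<in> E - M" "h e3 = x" "c1 e2 \<noteq> c1 e3" for h :: "'a \<Rightarrow> 'z" and x e1 e2 e3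
  proof -
    have "card {e1, e2, e3} \<le> card (fiber E h x)"
      using that fin by (intro card_mono) (auto simp: M_def)
    moreover have "card {e1, e2, e3} = 3" using that by (auto simp: card_insert_if)
    ultimately show False using that(1) by simp
  qed
  \<comment> \<open>With both ends of degree 2, \<open>e\<close> lies in \<open>H\<close>. Its
    neighbours both differ from it under the two-valued \<open>c1\<close>, so they agree, and the
    two ends make the same demand on \<open>e\<close>.\<close>
  have across: False if "e \<in> M" "card (fiber E f (f e)) = 2" "card (fiber E g (g e)) = 2"
      "e1 \<in> E - M" "f e1 = f e" "e2 \<in> E - M" "g e2 = g e" "c1 e1 \<noteq> c1 e2" for e e1 e2
  proof -
    have H: "e \<in> H" "e1 \<in> H" "e2 \<in> H" using that(1-4,6) EH unfolding H_def M_def by blast+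
    have "c1 e1 \<noteq> c1 e" using proper_atD[OF c1(2) H(2,1)] that by auto
    moreover have "c1 e2 \<noteq> c1 e" using proper_atD[OF c1(3) H(3,1)] that by auto
    ultimately show False using that(8) c1_less[OF H(1)] c1_less[OF H(2)] c1_less[OF H(3)] by linarith
  qed
  have cf: "c e = (if c1 e' = 1 then 4 else 1)"
    if "card (fiber E f x) = 2" "e \<in> fiber E f x \<inter> M" "e' \<in> fiber E f x - M" for x e e'
  proof (cases "c1 e' = 1")
    case True
    then have "next4 e" unfolding next4_def using that by auto
    then show ?thesis using True that by (simp add: c_def)
  next
    case False
    \<comment> \<open>A witness for \<open>next4\<close> at the same end contradicts
      \<open>no_three\<close>, one at the opposite end contradicts \<open>across\<close>.\<close>
    have "\<not> next4 e"
    proof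
      assume "next4 e"
      then obtain e2 where "e2 \<in> E - M" "c1 e2 = 1"
        "f e2 = f e \<or> (card (fiber E g (g e)) = 2 \<and> g e2 = g e)" unfolding next4_def by blast
      then show False
        using no_three[of f x e e' e2] across[of e e' e2] that False by auto
    qed
    then show ?thesis using False that by (simp add: c_def)
  qed
  have cg: "c e = (if c1 e' = 1 then 4 else 1)"
    if "card (fiber E g x) = 2" "e \<in> fiber E g x \<inter> M" "e' \<in> fiber E g x - M" for x e e'
  proof (cases "c1 e' = 1")
    case True
    then have "next4 e" unfolding next4_def using that by auto
    then show ?thesis using True that by (simp add: c_def)
  next
    case False
    have "\<not> next4 e"
    proof
      assume "next4 e"
      then obtain e2 where "e2 \<in> E - M" "c1 e2 = 1"
        "g e2 = g e \<or> (card (fiber E f (f e)) = 2 \<and> f e2 = f e)" unfolding next4_def by blast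
      then show False
        using no_three[of g x e e' e2] across[of e e2 e'] that False by auto
    qed
    then show ?thesis using False that by (simp add: c_def)
  qed
  have side: "inj_on c (fiber E h x) \<and> c ` fiber E h x \<subseteq> {1..4} \<and> (\<exists>a b. c ` fiber E h x = {a..b})"
    if le: "card (fiber E h x) \<le> 3" and p0: "proper_at E h c0" and p1: "proper_at H h c1"
      and pair: "\<And>e e'. card (fiber E h x) = 2 \<Longrightarrow> e \<in> fiber E h x \<inter> M \<Longrightarrow> e' \<in> fiber E h x - M
        \<Longrightarrow> c e = (if c1 e' = 1 then 4 else 1)"
    for h :: "'a \<Rightarrow> 'z" and x
  proof (rule interval_fiber[where M = M and ?c1.0 = c1])
    show "finite (fiber E h x)" using fin by simp
    show "fiber E h x \<inter> M \<noteq> {}" if "card (fiber E h x) = 3" by (rule Mcov[OF p0 that])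
    show "e = e'" if "e \<in> fiber E h x \<inter> M" "e' \<in> fiber E h x \<inter> M" for e e'
      using proper_atD[OF p0, of e e'] that by (auto simp: M_def)
    show "inj_on c1 (fiber E h x - M)"
      by (rule inj_on_subset[OF proper_at_inj_on[OF p1, of x]]) (use EH in auto)
    show "c1 e < 2" if "e \<in> fiber E h x - M" for e using that EH c1_less by blast
    show "c e = (if c1 e' = 1 then 4 else 1)"
      if "card (fiber E h x) = 2" "e \<in> fiber E h x \<inter> M" "e' \<in> fiber E h x - M" for e e'
      by (rule pair[OF that])
  qed (auto simp: c_def le)
  have "interval4_at E f c"
    unfolding interval4_at_def by (intro allI side[OF df c0(2) c1(2) cf])
  moreover have "interval4_at E g c"
    unfolding interval4_at_def by (intro allI side[OF dg c0(3) c1(3) cg])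
  ultimately show ?thesis by blast
qed

lemma interval_image_of_blocks:
  fixes c :: "'e \<Rightarrow> nat"
  assumes fin: "finite E"
    and blocks: "interval4_at E (\<lambda>e. (f e, i e)) c"
    and idx: "\<And>e. e \<in> E \<Longrightarrow> 3 * i e < card (fiber E f (f e))"
    and full: "\<And>x. 3 \<le> card (fiber E f x) \<Longrightarrow> card (fiber E (\<lambda>e. (f e, i e)) (x, 0)) = 3"
  shows "\<exists>a b. c ` fiber E f x = {a..b}"
proof (cases "3 \<le> card (fiber E f x)")
  case False
  \<comment> \<open>Below degree 3 the whole vertex is block 0, where the colours already form an
    interval.\<close>
  have "i e = 0" if "e \<in> fiber E f x" for e using idx[of e] that False by auto
  then have eq: "fiber E f x = fiber E (\<lambda>e. (f e, i e)) (x, 0)" by auto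
  show ?thesis unfolding eq using blocks unfolding interval4_at_def by blast
next
  case True
  let ?B = "fiber E (\<lambda>e. (f e, i e)) (x, 0)"
  have B: "inj_on c ?B" "c ` ?B \<subseteq> {1..4}" "\<exists>a b. c ` ?B = {a..b}"
    using blocks unfolding interval4_at_def by blast+
  then obtain a b where ab: "c ` ?B = {a..b}" by blast
  have "card {a..b} = 3"
    using full[OF True] ab card_image[OF B(1)] by simp
  then have b: "b = a + 2" by auto
  have "{a..b} \<subseteq> {1..4}" using ab B(2) by simp
  then have a: "a = 1 \<or> a = 2" using b by auto
  have ins: "{1..4} = insert 4 {1..3::nat}" "{1..4} = insert 1 {2..4::nat}" by auto
  have sub: "{a..b} \<subseteq> c ` fiber E f x" unfolding ab[symmetric] by auto
  have range: "c ` fiber E f x \<subseteq> {1..4}"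
    using blocks by (fastforce simp: interval4_at_def)
  \<comment> \<open>The full block leaves just one colour of \<open>{1..4}\<close> undecided, so the
    image is the block's interval or all of \<open>{1..4}\<close>.\<close>
  have between: "I = A \<or> I = insert z A" if "A \<subseteq> I" "I \<subseteq> insert z A" for A I and z :: nat
    using that by (cases "z \<in> I") auto
  from a have "{1..3} \<subseteq> c ` fiber E f x \<and> c ` fiber E f x \<subseteq> insert 4 {1..3} \<or>
    {2..4} \<subseteq> c ` fiber E f x \<and> c ` fiber E f x \<subseteq> insert 1 {2..4}"
  proof (elim disjE)
    assume "a = 1"
    then have "{a..b} = {1..3}" using b by simp
    then show ?thesis using sub range unfolding ins(1) by simp
  next
    assume "a = 2"
    then have "{a..b} = {2..4}" using b by simp
    then show ?thesis using sub range unfolding ins(2) by simp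
  qed
  then have "c ` fiber E f x \<in> {{1..3}, {2..4}, insert 4 {1..3}, insert 1 {2..4}}"
    using between[of "{1..3}" "c ` fiber E f x" 4] between[of "{2..4}" "c ` fiber E f x" 1] by auto
  then show ?thesis unfolding ins[symmetric] by blast
qed

theorem improper_interval_colouring_three:
  assumes "finite E"
  shows "\<exists>c :: 'e \<Rightarrow> nat. \<forall>K.
    (\<forall>x. card (fiber E f x) \<le> K * 3 \<longrightarrow> (\<forall>k. card {e \<in> fiber E f x. c e = k} \<le> K)) \<and>
    (\<forall>y. card (fiber E g y) \<le> K * 3 \<longrightarrow> (\<forall>k. card {e \<in> fiber E g y. c e = k} \<le> K)) \<and>
    (\<forall>x. \<exists>a b. c ` fiber E f x = {a..b}) \<and> (\<forall>y. \<exists>a b. c ` fiber E g y = {a..b})"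
proof -
  have "(3::nat) > 0" by simp
  note bl = block_index[OF assms this]
  obtain i where i: "\<And>p. card (fiber E (\<lambda>e. (f e, i e)) p) \<le> 3"
      "\<And>e. e \<in> E \<Longrightarrow> 3 * i e < card (fiber E f (f e))"
      "\<And>x. 3 \<le> card (fiber E f x) \<Longrightarrow> card (fiber E (\<lambda>e. (f e, i e)) (x, 0)) = 3"
    using bl[of f] by blast
  obtain j where j: "\<And>p. card (fiber E (\<lambda>e. (g e, j e)) p) \<le> 3"
      "\<And>e. e \<in> E \<Longrightarrow> 3 * j e < card (fiber E g (g e))"
      "\<And>y. 3 \<le> card (fiber E g y) \<Longrightarrow> card (fiber E (\<lambda>e. (g e, j e)) (y, 0)) = 3"
    using bl[of g] by blast
  obtain c where c: "interval4_at E (\<lambda>e. (f e, i e)) c" "interval4_at E (\<lambda>e. (g e, j e)) c"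
    using subcubic_interval_colouring[OF assms i(1) j(1)] by blast
  show ?thesis
    using blockwise_proper_card_le[OF assms interval4_at_imp_proper_at[OF c(1)] i(2)]
      blockwise_proper_card_le[OF assms interval4_at_imp_proper_at[OF c(2)] j(2)]
      interval_image_of_blocks[OF assms c(1) i(2,3)] interval_image_of_blocks[OF assms c(2) j(2,3)]
    by (intro exI[of _ c]) blast
qed

section \<open>Bipartite graphs\<close>

lemma mu_int_le:
  assumes "improper_edge_coloring K V E c" "interval_edge_coloring V E c"
  shows "mu_int V E \<le> K"
  unfolding mu_int_def using assms by (intro Least_le) blast

text \<open>Passage from edges as vertex sets to end maps: \<open>f\<close> picks the end in one
  part, \<open>g\<close> the end in the other, and each vertex is seen by the map of its own
  part.\<close>

lemma bipartite_ends:
  assumes "bipartite V E"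
  obtains f g where "\<And>v. v \<in> V \<Longrightarrow> incident_edges E v = fiber E f v \<or> incident_edges E v = fiber E g v"
proof -
  obtain X Y where XY: "X \<union> Y = V" "X \<inter> Y = {}" "\<forall>e\<in>E. \<exists>x\<in>X. \<exists>y\<in>Y. e = {x, y}"
    using assms unfolding bipartite_def by blast
  then have "\<forall>e\<in>E. \<exists>x y. x \<in> X \<and> y \<in> Y \<and> (\<forall>v. v \<in> e \<longleftrightarrow> v = x \<or> v = y)"
    by fastforce
  then obtain f g where fg: "\<forall>e\<in>E. f e \<in> X \<and> g e \<in> Y \<and> (\<forall>v. v \<in> e \<longleftrightarrow> v = f e \<or> v = g e)"
    by metis
  have "incident_edges E v = fiber E f v \<or> incident_edges E v = fiber E g v" if "v \<in> V" for v
  proof (cases "v \<in> X")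
    case True
    then have "v \<in> e \<longleftrightarrow> f e = v" if "e \<in> E" for e using fg XY(2) that by (metis IntI empty_iff)
    then show ?thesis unfolding incident_edges_def by auto
  next
    case False
    then have "v \<in> e \<longleftrightarrow> g e = v" if "e \<in> E" for e using fg that by metis
    then show ?thesis unfolding incident_edges_def by auto
  qed
  then show thesis using that by blast
qed

lemma degree_le_max_degree: "finite V \<Longrightarrow> v \<in> V \<Longrightarrow> degree E v \<le> max_degree V E"
  unfolding max_degree_def by simp

lemma min_degree_le_degree: "finite V \<Longrightarrow> v \<in> V \<Longrightarrow> min_degree V E \<le> degree E v"
  unfolding min_degree_def by simp

lemma le_nat_ceiling_divide_mult:
  fixes m t :: nat
  assumes "t > 0"
  shows "m \<le> nat \<lceil>real m / real t\<rceil> * t"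
proof -
  have "real m / real t \<le> real (nat \<lceil>real m / real t\<rceil>)" by (rule real_nat_ceiling_ge)
  then have "real m \<le> real (nat \<lceil>real m / real t\<rceil>) * real t"
    using assms by (subst (asm) pos_divide_le_eq) auto
  then show ?thesis by (metis of_nat_le_iff of_nat_mult)
qed

theorem theorem17:
  fixes V :: "'a set" and E :: "'a set set"
  assumes "simple_graph V E" and "bipartite V E"
  shows "(min_degree V E \<ge> 1 \<longrightarrow>
            int (mu_int V E) \<le> \<lceil>real (max_degree V E) / real (min_degree V E)\<rceil>) \<and>
         int (mu_int V E) \<le> \<lceil>real (max_degree V E) / 3\<rceil>"
proof -
  have finV: "finite V" using assms(1) by (simp add: simple_graph_def)
  have finE: "finite E" using assms(1) by (rule simple_graph_finite_edges)
  obtain f g where inc: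
    "\<And>v. v \<in> V \<Longrightarrow> incident_edges E v = fiber E f v \<or> incident_edges E v = fiber E g v"
    using bipartite_ends[OF assms(2)] by blast
  \<comment> \<open>Common to both parts: a colouring good for every \<open>K\<close> is used with
    \<open>K\<close> the rounded-up quotient of the maximum degree by \<open>t\<close>.\<close>
  have bound: "int (mu_int V E) \<le> \<lceil>real (max_degree V E) / real t\<rceil>"
    if t: "t > 0" and ex: "\<exists>c :: 'a set \<Rightarrow> nat. \<forall>v\<in>V. (\<exists>a b. c ` incident_edges E v = {a..b}) \<and>
      (\<forall>K. degree E v \<le> K * t \<longrightarrow> (\<forall>k. card {e \<in> incident_edges E v. c e = k} \<le> K))" for t
  proof -
    let ?K = "nat \<lceil>real (max_degree V E) / real t\<rceil>"
    obtain c :: "'a set \<Rightarrow> nat" where c: "\<forall>v\<in>V. (\<exists>a b. c ` incident_edges E v = {a..b}) \<and>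
      (\<forall>K. degree E v \<le> K * t \<longrightarrow> (\<forall>k. card {e \<in> incident_edges E v. c e = k} \<le> K))"
      using ex by (rule exE)
    have "degree E v \<le> ?K * t" if "v \<in> V" for v
      using degree_le_max_degree[OF finV that] le_nat_ceiling_divide_mult[OF t] by (rule order_trans)
    then have "mu_int V E \<le> ?K"
      using c
      by (intro mu_int_le[of ?K V E c]) (simp_all add: improper_edge_coloring_def interval_edge_coloring_def)
    moreover have "0 \<le> \<lceil>real (max_degree V E) / real t\<rceil>"
      by (rule order_trans[OF _ ceiling_mono[of 0]]) simp_all
    ultimately show ?thesis by linarith
  qed
  have "int (mu_int V E) \<le> \<lceil>real (max_degree V E) / real (min_degree V E)\<rceil>" if "min_degree V E \<ge> 1"
  proof (rule bound)
    let ?t = "min_degree V E"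
    show t: "?t > 0" using that by simp
    obtain c where c: "\<forall>K.
      (\<forall>x. card (fiber E f x) \<le> K * ?t \<longrightarrow> (\<forall>k. card {e \<in> fiber E f x. c e = k} \<le> K)) \<and>
      (\<forall>y. card (fiber E g y) \<le> K * ?t \<longrightarrow> (\<forall>k. card {e \<in> fiber E g y. c e = k} \<le> K)) \<and>
      (\<forall>x. ?t \<le> card (fiber E f x) \<longrightarrow> c ` fiber E f x = {..<?t}) \<and>
      (\<forall>y. ?t \<le> card (fiber E g y) \<longrightarrow> c ` fiber E g y = {..<?t})"
      using balanced_edge_colouring[OF finE t, of f g] by (rule exE)
    \<comment> \<open>Positivity of the minimum degree makes the truncated subtraction
      exact.\<close>
    have iv: "{..<?t} = {0..?t - 1}" using t by auto
    have "(\<exists>a b. c ` incident_edges E v = {a..b}) \<and>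
      (\<forall>K. degree E v \<le> K * ?t \<longrightarrow> (\<forall>k. card {e \<in> incident_edges E v. c e = k} \<le> K))" if "v \<in> V" for v
    proof -
      have deg: "?t \<le> card (incident_edges E v)"
        using min_degree_le_degree[OF finV that] by (simp add: degree_def)
      from inc[OF that] show ?thesis
      proof
        assume "incident_edges E v = fiber E f v"
        then show ?thesis using deg c iv unfolding degree_def by auto
      next
        assume "incident_edges E v = fiber E g v"
        then show ?thesis using deg c iv unfolding degree_def by auto
      qed
    qed
    then show "\<exists>c :: 'a set \<Rightarrow> nat. \<forall>v\<in>V. (\<exists>a b. c ` incident_edges E v = {a..b}) \<and>
      (\<forall>K. degree E v \<le> K * ?t \<longrightarrow> (\<forall>k. card {e \<in> incident_edges E v. c e = k} \<le> K))" by blast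
  qed
  moreover have "int (mu_int V E) \<le> \<lceil>real (max_degree V E) / real 3\<rceil>"
  proof (rule bound)
    obtain c :: "'a set \<Rightarrow> nat" where c: "\<forall>K.
      (\<forall>x. card (fiber E f x) \<le> K * 3 \<longrightarrow> (\<forall>k. card {e \<in> fiber E f x. c e = k} \<le> K)) \<and>
      (\<forall>y. card (fiber E g y) \<le> K * 3 \<longrightarrow> (\<forall>k. card {e \<in> fiber E g y. c e = k} \<le> K)) \<and>
      (\<forall>x. \<exists>a b. c ` fiber E f x = {a..b}) \<and> (\<forall>y. \<exists>a b. c ` fiber E g y = {a..b})"
      using improper_interval_colouring_three[OF finE, of f g] by (rule exE)
    have "(\<exists>a b. c ` incident_edges E v = {a..b}) \<and>
      (\<forall>K. degree E v \<le> K * 3 \<longrightarrow> (\<forall>k. card {e \<in> incident_edges E v. c e = k} \<le> K))" if "v \<in> V" for v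
      using inc[OF that]
    proof
      assume "incident_edges E v = fiber E f v"
      then show ?thesis using c unfolding degree_def by auto
    next
      assume "incident_edges E v = fiber E g v"
      then show ?thesis using c unfolding degree_def by auto
    qed
    then show "\<exists>c :: 'a set \<Rightarrow> nat. \<forall>v\<in>V. (\<exists>a b. c ` incident_edges E v = {a..b}) \<and>
      (\<forall>K. degree E v \<le> K * 3 \<longrightarrow> (\<forall>k. card {e \<in> incident_edges E v. c e = k} \<le> K))" by blast
  qed simp
  ultimately show ?thesis by simp
qed

end
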